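(* Let $M$ be a surface immersed in $\mathbb{R}^4$ and $m\in M$. If a vector $0\ne x\in T_mM$ defines a strong principal direction at $m$, then it satisfies the following conditions: 1. $\alpha(x,x) \ne 0$; 2. $J\alpha(x,x)\cdot\alpha(x,Jx)\ne 0$ or $\alpha(x,Jx)=0$; 3. $\det\big(\alpha(x,Jx),(\nabla_x\alpha)(x,x)\big)=0$, where the determinant is that of two vectors in the two-dimensional space $N_mM$.
   Context: $D$ denotes the directional derivative in $\mathbb{R}^4$, $g$ the first fundamental form, $N_mM$ the normal plane of $M$ at $m$, and $X=X^\top+X^\bot$ the decomposition into tangent and normal parts. The second fundamental form is $\alpha(X,Y)=(D_XY)^\bot$; with $\nabla^\top_XY=(D_XY)^\top$ and $\nabla^\bot_Xu=(D_Xu)^\bot$, its covariant derivative is $(\nabla_X\alpha)(Y,Z)=\nabla^\bot_X(\alpha(Y,Z))-\alpha(\nabla^\top_XY,Z)-\alpha(Y,\nabla^\top_XZ)$. $J$ denotes a rotation by 90 degrees in the plane $T_mM$ and also a rotation by 90 degrees in the plane $N_mM$ (for chosen orientations). The determinant in $N_mM$ is taken with respect to an orthonormal basis. For $0\neq u\in\mathbb{R}^4$, let $d_{3,u}$ be the third order Taylor polynomial at $0$ of the function $x\in T_mM\mapsto \|\exp_m(x)-(m+u)\|^2-\|u\|^2$, where $\exp_m$ is the exponential map of $M$ at $m$; explicitly $$d_{3,u}(x)=-2u\cdot x+x\cdot x-u\cdot \alpha(x,x)+\tfrac13\alpha(u^\top,x)\cdot\alpha(x,x)-\tfrac13 u^\bot\cdot(\nabla_x\alpha)(x,x).$$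 A vector $0\neq x\in T_mM$ defines a strong principal direction at $m$ if there is $0\ne u\in\mathbb{R}^4$ (said to determine a rib direction at $m$) such that: (i) $u\in N_mM$; (ii) $g(x,\cdot)-u\cdot\alpha(x,\cdot)=0$ on $T_mM$; (iii) $d_{3,u}(x)=0$. *)

theory Defs
  imports "HOL-Analysis.Analysis"
begin

section \<open>Smooth maps\<close>

fun Ck_on :: "nat \<Rightarrow> 'a::real_normed_vector set \<Rightarrow> ('a \<Rightarrow> 'b::real_normed_vector) \<Rightarrow> bool" where
  "Ck_on 0 S f \<longleftrightarrow> continuous_on S f"
| "Ck_on (Suc k) S f \<longleftrightarrow> (\<forall>p\<in>S. f differentiable (at p)) \<and>
     (\<forall>v. Ck_on k S (\<lambda>p. frechet_derivative f (at p) v))"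

text \<open>Only used for open \<open>S\<close>.\<close>

definition smooth_on :: "'a::real_normed_vector set \<Rightarrow> ('a \<Rightarrow> 'b::real_normed_vector) \<Rightarrow> bool" where
  "smooth_on S f \<longleftrightarrow> (\<forall>k. Ck_on k S f)"


section \<open>Surfaces immersed in \<open>\<real>\<^sup>4\<close>\<close>

type_synonym 'a chart = "'a set \<times> ('a \<Rightarrow> real^2)"

text \<open>An abstract surface, given by a topology and an atlas, together with a map to \<open>\<real>\<^sup>4\<close>.
  The map need not be injective, so a point of the surface is an element of \<open>'a\<close>, not a
  point of \<open>\<real>\<^sup>4\<close>.\<close>

record 'a surface =
  points :: "'a topology"
  charts :: "'a chart set"
  imm :: "'a \<Rightarrow> real^4"

text \<open>A function on the surface, read in a chart.\<close>

definition in_chart :: "'a chart \<Rightarrow> ('a \<Rightarrow> 'b) \<Rightarrow> real^2 \<Rightarrow> 'b" where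
  "in_chart c h = h \<circ> inv_into (fst c) (snd c)"

definition smooth_surface :: "'a surface \<Rightarrow> bool" where
  "smooth_surface M \<longleftrightarrow>
     Hausdorff_space (points M) \<and> second_countable (points M) \<and>
     topspace (points M) = (\<Union>c\<in>charts M. fst c) \<and>
     (\<forall>(V, \<psi>)\<in>charts M. openin (points M) V \<and> open (\<psi> ` V) \<and>
        homeomorphic_map (subtopology (points M) V) (top_of_set (\<psi> ` V)) \<psi>) \<and>
     (\<forall>(V, \<psi>)\<in>charts M. \<forall>(V', \<psi>')\<in>charts M. smooth_on (\<psi> ` (V \<inter> V')) (in_chart (V, \<psi>) \<psi>'))"

definition immersed_surface :: "'a surface \<Rightarrow> bool" where
  "immersed_surface M \<longleftrightarrow> smooth_surface M \<and>
     (\<forall>(V, \<psi>)\<in>charts M. smooth_on (\<psi> ` V) (in_chart (V, \<psi>) (imm M)) \<and>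
        (\<forall>p\<in>\<psi> ` V. inj (frechet_derivative (in_chart (V, \<psi>) (imm M)) (at p))))"


section \<open>Tangent and normal planes, directional derivative\<close>

definition chart_at :: "'a surface \<Rightarrow> 'a \<Rightarrow> 'a chart" where
  "chart_at M m = (SOME c. c \<in> charts M \<and> m \<in> fst c)"

text \<open>The derivative of a function on the surface at \<open>m\<close>, along the tangent vector
  whose coordinates in the chart \<open>c\<close> are \<open>v\<close>.\<close>

definition chart_deriv :: "'a chart \<Rightarrow> ('a \<Rightarrow> real^4) \<Rightarrow> 'a \<Rightarrow> real^2 \<Rightarrow> real^4" where
  "chart_deriv c h m = frechet_derivative (in_chart c h) (at (snd c m))"

text \<open>The tangent plane, as a linear subspace of \<open>\<real>\<^sup>4\<close>; independent of the chart by
  \<open>tangent_plane_eq\<close> below.\<close>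

definition tangent_plane :: "'a surface \<Rightarrow> 'a \<Rightarrow> (real^4) set" where
  "tangent_plane M m = range (chart_deriv (chart_at M m) (imm M) m)"

definition normal_plane :: "'a surface \<Rightarrow> 'a \<Rightarrow> (real^4) set" where
  "normal_plane M m = orthogonal_comp (tangent_plane M m)"

definition tangential :: "'a surface \<Rightarrow> 'a \<Rightarrow> real^4 \<Rightarrow> real^4" where
  "tangential M m v = (THE y. y \<in> tangent_plane M m \<and> v - y \<in> normal_plane M m)"

definition normal :: "'a surface \<Rightarrow> 'a \<Rightarrow> real^4 \<Rightarrow> real^4" where
  "normal M m v = v - tangential M m v"

text \<open>The coordinates of a tangent vector in the chart used at \<open>m\<close>.\<close>

definition coords :: "'a surface \<Rightarrow> 'a \<Rightarrow> real^4 \<Rightarrow> real^2" where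
  "coords M m x = inv (chart_deriv (chart_at M m) (imm M) m) x"

text \<open>The directional derivative \<open>D\<^sub>x Y\<close> of a vector field \<open>Y\<close> along the immersion, at \<open>m\<close>
  in the direction of the tangent vector \<open>x\<close>; independent of the chart by \<open>dir_deriv_eq\<close>.\<close>

definition dir_deriv :: "'a surface \<Rightarrow> 'a \<Rightarrow> real^4 \<Rightarrow> ('a \<Rightarrow> real^4) \<Rightarrow> real^4" where
  "dir_deriv M m x Y = chart_deriv (chart_at M m) Y m (coords M m x)"


section \<open>Connections and the second fundamental form\<close>

text \<open>The operators on vector fields; \<open>X\<close>, \<open>Y\<close>, \<open>Z\<close> are tangent fields and \<open>u\<close> is a normal field.\<close>

definition second_ff_field ::
  "'a surface \<Rightarrow> ('a \<Rightarrow> real^4) \<Rightarrow> ('a \<Rightarrow> real^4) \<Rightarrow> 'a \<Rightarrow> real^4" where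
  "second_ff_field M X Y q = normal M q (dir_deriv M q (X q) Y)"

definition tangent_conn ::
  "'a surface \<Rightarrow> ('a \<Rightarrow> real^4) \<Rightarrow> ('a \<Rightarrow> real^4) \<Rightarrow> 'a \<Rightarrow> real^4" where
  "tangent_conn M X Y q = tangential M q (dir_deriv M q (X q) Y)"

definition normal_conn ::
  "'a surface \<Rightarrow> ('a \<Rightarrow> real^4) \<Rightarrow> ('a \<Rightarrow> real^4) \<Rightarrow> 'a \<Rightarrow> real^4" where
  "normal_conn M X u q = normal M q (dir_deriv M q (X q) u)"

definition cov_deriv_second_ff_field ::
  "'a surface \<Rightarrow> ('a \<Rightarrow> real^4) \<Rightarrow> ('a \<Rightarrow> real^4) \<Rightarrow> ('a \<Rightarrow> real^4) \<Rightarrow> 'a \<Rightarrow> real^4" where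
  "cov_deriv_second_ff_field M X Y Z q =
     normal_conn M X (second_ff_field M Y Z) q
     - second_ff_field M (tangent_conn M X Y) Z q
     - second_ff_field M Y (tangent_conn M X Z) q"

text \<open>To evaluate the tensors on tangent vectors at \<open>m\<close>, extend these to the tangent fields
  near \<open>m\<close> with constant coordinates in the chart used at \<open>m\<close>.  Any other extension gives the
  same value: \<open>second_ff_field_eq\<close> and \<open>cov_deriv_second_ff_field_eq\<close>.\<close>

definition extend :: "'a surface \<Rightarrow> 'a \<Rightarrow> real^4 \<Rightarrow> 'a \<Rightarrow> real^4" where
  "extend M m x q = chart_deriv (chart_at M m) (imm M) q (coords M m x)"

definition second_ff :: "'a surface \<Rightarrow> 'a \<Rightarrow> real^4 \<Rightarrow> real^4 \<Rightarrow> real^4" where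
  "second_ff M m x y = second_ff_field M (extend M m x) (extend M m y) m"

definition cov_deriv_second_ff ::
  "'a surface \<Rightarrow> 'a \<Rightarrow> real^4 \<Rightarrow> real^4 \<Rightarrow> real^4 \<Rightarrow> real^4" where
  "cov_deriv_second_ff M m x y z =
     cov_deriv_second_ff_field M (extend M m x) (extend M m y) (extend M m z) m"

text \<open>A smooth tangent field near \<open>m\<close>: its coordinates \<open>a\<close> are smooth.\<close>

definition tangent_field_near :: "'a surface \<Rightarrow> 'a \<Rightarrow> ('a \<Rightarrow> real^4) \<Rightarrow> bool" where
  "tangent_field_near M m X \<longleftrightarrow> (let c = chart_at M m in
     \<exists>P a. open P \<and> snd c m \<in> P \<and> P \<subseteq> snd c ` fst c \<and> smooth_on P a \<and>
       (\<forall>p\<in>P. in_chart c X p = frechet_derivative (in_chart c (imm M)) (at p) (a p)))"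


section \<open>Strong principal directions\<close>

text \<open>The third order Taylor polynomial at \<open>0\<close> of
  \<open>x \<mapsto> \<parallel>exp\<^sub>m x - (m + u)\<parallel>\<^sup>2 - \<parallel>u\<parallel>\<^sup>2\<close> on the tangent plane at \<open>m\<close>, in explicit form:
  the geodesic \<open>\<gamma>\<close> with \<open>\<gamma>(0) = m\<close> and velocity \<open>x\<close> has second derivative \<open>\<alpha>(x, x)\<close> at \<open>0\<close>,
  and its third derivative has inner product
  \<open>u\<^sup>\<bottom> \<bullet> (\<nabla>\<^sub>x \<alpha>)(x, x) - \<alpha>(u\<^sup>\<top>, x) \<bullet> \<alpha>(x, x)\<close> with \<open>u\<close>.\<close>

definition d3 :: "'a surface \<Rightarrow> 'a \<Rightarrow> real^4 \<Rightarrow> real^4 \<Rightarrow> real" where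
  "d3 M m u x =
     - 2 * (u \<bullet> x) + x \<bullet> x - u \<bullet> second_ff M m x x
     + 1/3 * (second_ff M m (tangential M m u) x \<bullet> second_ff M m x x)
     - 1/3 * (normal M m u \<bullet> cov_deriv_second_ff M m x x x)"

definition determines_rib_direction :: "'a surface \<Rightarrow> 'a \<Rightarrow> real^4 \<Rightarrow> real^4 \<Rightarrow> bool" where
  "determines_rib_direction M m x u \<longleftrightarrow>
     u \<noteq> 0 \<and> u \<in> normal_plane M m \<and>
     (\<forall>y\<in>tangent_plane M m. x \<bullet> y - u \<bullet> second_ff M m x y = 0) \<and>
     d3 M m u x = 0"

definition strong_principal_direction :: "'a surface \<Rightarrow> 'a \<Rightarrow> real^4 \<Rightarrow> bool" where
  "strong_principal_direction M m x \<longleftrightarrow>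
     x \<noteq> 0 \<and> x \<in> tangent_plane M m \<and> (\<exists>u. determines_rib_direction M m x u)"


section \<open>Oriented planes\<close>

definition orthonormal_basis :: "(real^4) set \<Rightarrow> real^4 \<Rightarrow> real^4 \<Rightarrow> bool" where
  "orthonormal_basis P e1 e2 \<longleftrightarrow>
     norm e1 = 1 \<and> norm e2 = 1 \<and> orthogonal e1 e2 \<and> span {e1, e2} = P"

text \<open>Rotation by 90 degrees in the plane \<open>P\<close>, for one of its two orientations: the one in
  which \<open>(e1, e2)\<close> is positive.\<close>

definition rotation90_on :: "(real^4) set \<Rightarrow> (real^4 \<Rightarrow> real^4) \<Rightarrow> bool" where
  "rotation90_on P J \<longleftrightarrow>
     (\<exists>e1 e2. orthonormal_basis P e1 e2 \<and>
        (\<forall>a b. J (a *\<^sub>R e1 + b *\<^sub>R e2) = a *\<^sub>R e2 - b *\<^sub>R e1))"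

definition plane_det :: "real^4 \<Rightarrow> real^4 \<Rightarrow> real^4 \<Rightarrow> real^4 \<Rightarrow> real" where
  "plane_det e1 e2 v w = det (vector [vector [v \<bullet> e1, v \<bullet> e2], vector [w \<bullet> e1, w \<bullet> e2]] :: real^2^2)"

lemma Ck_on_open_mono: "Ck_on k S f \<Longrightarrow> T \<subseteq> S \<Longrightarrow> Ck_on k T f"
  by (induction k arbitrary: f) (auto intro: continuous_on_subset)

lemma smooth_on_differentiable: "smooth_on S f \<Longrightarrow> p \<in> S \<Longrightarrow> f differentiable (at p)"
  unfolding smooth_on_def by (metis Ck_on.simps(2))

lemma smooth_on_frechet_derivative:
  "smooth_on S f \<Longrightarrow> smooth_on S (\<lambda>p. frechet_derivative f (at p) v)"
  unfolding smooth_on_def by (metis Ck_on.simps(2))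

section \<open>Independence of the chart\<close>

lemma chart_at:
  assumes "immersed_surface M" "m \<in> topspace (points M)"
  shows "chart_at M m \<in> charts M \<and> m \<in> fst (chart_at M m)"
proof -
  have "\<exists>c. c \<in> charts M \<and> m \<in> fst c"
    using assms unfolding immersed_surface_def smooth_surface_def by auto
  then show ?thesis unfolding chart_at_def by (rule someI_ex)
qed

lemma chart_facts:
  assumes "immersed_surface M" "c \<in> charts M"
  shows "openin (points M) (fst c)" "open (snd c ` fst c)" "inj_on (snd c) (fst c)"
    "fst c \<subseteq> topspace (points M)"
    "homeomorphic_map (subtopology (points M) (fst c)) (top_of_set (snd c ` fst c)) (snd c)"
    "smooth_on (snd c ` fst c) (in_chart c (imm M))"
    "m \<in> fst c \<Longrightarrow> inj (chart_deriv c (imm M) m)"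
proof -
  show o: "openin (points M) (fst c)" "open (snd c ` fst c)"
    and h: "homeomorphic_map (subtopology (points M) (fst c)) (top_of_set (snd c ` fst c)) (snd c)"
    and "smooth_on (snd c ` fst c) (in_chart c (imm M))"
    and "m \<in> fst c \<Longrightarrow> inj (chart_deriv c (imm M) m)"
    using assms unfolding immersed_surface_def smooth_surface_def chart_deriv_def by fastforce+
  show "fst c \<subseteq> topspace (points M)" using o openin_subset by blast
  then show "inj_on (snd c) (fst c)"
    using homeomorphic_imp_injective_map[OF h] by (simp add: Int_absorb1)
qed

lemma in_chart_eq:
  assumes "immersed_surface M" "c \<in> charts M" "q \<in> fst c"
  shows "in_chart c h (snd c q) = h q"
  using chart_facts(3)[OF assms(1,2)] assms(3) by (simp add: in_chart_def inv_into_f_f)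

lemma open_chart_image:
  assumes "immersed_surface M" "c \<in> charts M" "openin (points M) W"
  shows "open (snd c ` (fst c \<inter> W))"
proof -
  note f = chart_facts[OF assms(1,2)]
  have "openin (subtopology (points M) (fst c)) (fst c \<inter> W)"
    using assms(3) by (simp add: openin_subtopology_Int2)
  then have "openin (top_of_set (snd c ` fst c)) (snd c ` (fst c \<inter> W))"
    using f(5) homeomorphic_imp_open_map open_map_def by blast
  then show ?thesis using f(2) openin_open_trans by blast
qed

lemma imm_differentiable:
  assumes "immersed_surface M" "c \<in> charts M" "m \<in> fst c"
  shows "in_chart c (imm M) differentiable (at (snd c m))"
  using smooth_on_differentiable[OF chart_facts(6)[OF assms(1,2)]] assms(3) by blast

lemma chart_change_aux:
  assumes M: "immersed_surface M" and c: "c \<in> charts M" "c' \<in> charts M"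
    and m: "m \<in> fst c" "m \<in> fst c'"
    and h: "in_chart c h differentiable (at (snd c m))"
  shows "in_chart c' h differentiable (at (snd c' m)) \<and> 
     chart_deriv c' h m = chart_deriv c h m \<circ> frechet_derivative (in_chart c' (snd c)) (at (snd c' m))"
proof -
  let ?p = "snd c' m" and ?\<tau> = "in_chart c' (snd c)"
  let ?S = "snd c' ` (fst c' \<inter> fst c)"
  have S: "open ?S" "?p \<in> ?S"
    using open_chart_image[OF M c(2) chart_facts(1)[OF M c(1)]] m by auto
  have "smooth_on ?S ?\<tau>"
    using M c unfolding immersed_surface_def smooth_surface_def by (fastforce simp: case_prod_beta)
  then have t: "(?\<tau> has_derivative frechet_derivative ?\<tau> (at ?p)) (at ?p)"
    using smooth_on_differentiable S(2) frechet_derivative_works by blast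
  have tp: "?\<tau> ?p = snd c m" using in_chart_eq[OF M c(2) m(2)] .
  have "(in_chart c h has_derivative chart_deriv c h m) (at (?\<tau> ?p))"
    using h frechet_derivative_works unfolding chart_deriv_def tp by blast
  from diff_chain_at[OF t this]
  have d: "(in_chart c h \<circ> ?\<tau> has_derivative chart_deriv c h m \<circ> frechet_derivative ?\<tau> (at ?p)) (at ?p)" .
  have "(in_chart c' h has_derivative chart_deriv c h m \<circ> frechet_derivative ?\<tau> (at ?p)) (at ?p)"
  proof (rule has_derivative_transform_within_open[OF d S])
    fix p assume "p \<in> ?S"
    then obtain q where q: "q \<in> fst c'" "q \<in> fst c" "p = snd c' q" by auto
    show "(in_chart c h \<circ> ?\<tau>) p = in_chart c' h p"
      using q c by (simp add: in_chart_eq[OF M])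
  qed
  then show ?thesis unfolding chart_deriv_def[of c']
    using frechet_derivative_at differentiableI by metis
qed

lemma chart_change:
  assumes M: "immersed_surface M" and c: "c \<in> charts M" "c' \<in> charts M"
    and m: "m \<in> fst c" "m \<in> fst c'"
  obtains \<tau> where "surj \<tau>"
    "\<And>h. in_chart c h differentiable (at (snd c m)) \<Longrightarrow> chart_deriv c' h m = chart_deriv c h m \<circ> \<tau>"
proof -
  define \<tau> where "\<tau> = frechet_derivative (in_chart c' (snd c)) (at (snd c' m))"
  have *: "\<And>h. in_chart c h differentiable (at (snd c m)) \<Longrightarrow> chart_deriv c' h m = chart_deriv c h m \<circ> \<tau>"
    unfolding \<tau>_def using chart_change_aux[OF assms] by blast
  have "chart_deriv c' (imm M) m = chart_deriv c (imm M) m \<circ> \<tau>"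
    using * imm_differentiable[OF M c(1) m(1)] by blast
  then have "inj \<tau>" using chart_facts(7)[OF M c(2) m(2)] inj_on_imageI2 by metis
  moreover have "linear \<tau>"
  proof -
    have "smooth_on (snd c' ` (fst c' \<inter> fst c)) (in_chart c' (snd c))"
      using M c unfolding immersed_surface_def smooth_surface_def by (fastforce simp: case_prod_beta)
    then show ?thesis unfolding \<tau>_def
      using smooth_on_differentiable m linear_frechet_derivative by blast
  qed
  ultimately have "surj \<tau>" using linear_injective_imp_surjective by blast
  then show ?thesis using * that by blast
qed

lemma tangent_plane_eq:
  assumes M: "immersed_surface M" and c: "c \<in> charts M" and m: "m \<in> fst c"
  shows "tangent_plane M m = range (chart_deriv c (imm M) m)"
proof -
  have mt: "m \<in> topspace (points M)" using chart_facts(4)[OF M c] m by blast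
  note c' = chart_at[OF M mt]
  obtain \<tau> where t: "surj \<tau>"
    "\<And>h. in_chart c h differentiable (at (snd c m)) \<Longrightarrow> chart_deriv (chart_at M m) h m = chart_deriv c h m \<circ> \<tau>"
    using chart_change[OF M c _ m] c' by metis
  show ?thesis unfolding tangent_plane_def t(2)[OF imm_differentiable[OF M c m]]
    using t(1) by (metis image_comp)
qed

lemma dir_deriv_eq:
  assumes M: "immersed_surface M" and c: "c \<in> charts M" and m: "m \<in> fst c"
    and Y: "in_chart c Y differentiable (at (snd c m))"
  shows "dir_deriv M m (chart_deriv c (imm M) m v) Y = chart_deriv c Y m v"
proof -
  have mt: "m \<in> topspace (points M)" using chart_facts(4)[OF M c] m by blast
  note c' = chart_at[OF M mt]
  obtain \<tau> where t: "surj \<tau>"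
    "\<And>h. in_chart c h differentiable (at (snd c m)) \<Longrightarrow> chart_deriv (chart_at M m) h m = chart_deriv c h m \<circ> \<tau>"
    using chart_change[OF M c _ m] c' by metis
  obtain w where w: "v = \<tau> w" using t(1) by blast
  have "chart_deriv c (imm M) m v = chart_deriv (chart_at M m) (imm M) m w"
    using t(2)[OF imm_differentiable[OF M c m]] w by simp
  then have "coords M m (chart_deriv c (imm M) m v) = w"
    unfolding coords_def using chart_facts(7)[OF M, of "chart_at M m"] c' by (simp add: inv_f_f)
  then show ?thesis unfolding dir_deriv_def using t(2)[OF Y] w by simp
qed

section \<open>Tangential and normal parts\<close>

lemma tangent_plane_subspace:
  assumes "immersed_surface M" "m \<in> topspace (points M)"
  shows "subspace (tangent_plane M m)" "dim (tangent_plane M m) = 2"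
proof -
  note c = chart_at[OF assms]
  have l: "linear (chart_deriv (chart_at M m) (imm M) m)"
    unfolding chart_deriv_def using imm_differentiable[OF assms(1)] c linear_frechet_derivative by blast
  show "subspace (tangent_plane M m)" unfolding tangent_plane_def
    using l by (simp add: linear_subspace_image)
  show "dim (tangent_plane M m) = 2" unfolding tangent_plane_def
    using dim_image_eq[OF l, of UNIV] chart_facts(7)[OF assms(1)] c by simp
qed

lemma tangential_normal:
  assumes "immersed_surface M" "m \<in> topspace (points M)"
  shows "tangential M m v \<in> tangent_plane M m" "normal M m v \<in> normal_plane M m"
    "\<And>y. y \<in> tangent_plane M m \<Longrightarrow> v - y \<in> normal_plane M m \<Longrightarrow> tangential M m v = y"
proof -
  note s = tangent_plane_subspace(1)[OF assms]
  let ?P = "\<lambda>y. y \<in> tangent_plane M m \<and> v - y \<in> normal_plane M m"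
  have uni: "y = z" if "?P y" "?P z" for y z
  proof -
    have "y - z \<in> tangent_plane M m" using that s subspace_diff by blast
    moreover have "orthogonal w (y - z)" if "w \<in> tangent_plane M m" for w
      using \<open>?P y\<close> \<open>?P z\<close> that unfolding normal_plane_def orthogonal_comp_def orthogonal_def
      by (simp add: inner_diff_right)
    ultimately show ?thesis by (metis orthogonal_self right_minus_eq)
  qed
  have "\<exists>y. ?P y"
  proof -
    obtain y z where yz: "y \<in> span (tangent_plane M m)"
      "\<And>w. w \<in> span (tangent_plane M m) \<Longrightarrow> orthogonal z w" "v = y + z"
      by (rule orthogonal_subspace_decomp_exists) blast
    have sp: "span (tangent_plane M m) = tangent_plane M m" using s by (simp add: span_eq_iff)
    have "?P y" using yz unfolding sp normal_plane_def orthogonal_comp_def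
      by (auto simp: orthogonal_commute)
    then show ?thesis ..
  qed
  then have e: "\<exists>!y. ?P y" using uni by blast
  then have "?P (tangential M m v)" unfolding tangential_def by (rule theI')
  then show "tangential M m v \<in> tangent_plane M m" "normal M m v \<in> normal_plane M m"
    unfolding normal_def by auto
  show "tangential M m v = y" if "y \<in> tangent_plane M m" "v - y \<in> normal_plane M m" for y
    using uni \<open>?P (tangential M m v)\<close> that by blast
qed


section \<open>Tensoriality\<close>

definition frame :: "'a surface \<Rightarrow> 'a chart \<Rightarrow> real^2 \<Rightarrow> real^2 \<Rightarrow> real^4" where
  "frame M c p w = frechet_derivative (in_chart c (imm M)) (at p) w"

definition hess :: "'a surface \<Rightarrow> 'a chart \<Rightarrow> real^2 \<Rightarrow> real^2 \<Rightarrow> real^2 \<Rightarrow> real^4" where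
  "hess M c p w v = frechet_derivative (\<lambda>p. frame M c p w) (at p) v"

definition gram :: "'a surface \<Rightarrow> 'a chart \<Rightarrow> real^2 \<Rightarrow> real" where
  "gram M c p = (frame M c p (axis 1 1) \<bullet> frame M c p (axis 1 1)) * (frame M c p (axis 2 1) \<bullet> frame M c p (axis 2 1))
     - (frame M c p (axis 1 1) \<bullet> frame M c p (axis 2 1))\<^sup>2"

definition coef :: "'a surface \<Rightarrow> 'a chart \<Rightarrow> real^2 \<Rightarrow> real^4 \<Rightarrow> real^2" where
  "coef M c p z = (let e1 = frame M c p (axis 1 1); e2 = frame M c p (axis 2 1) in
     (((e2 \<bullet> e2) * (z \<bullet> e1) - (e1 \<bullet> e2) * (z \<bullet> e2)) / gram M c p) *\<^sub>R axis 1 1 +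
     (((e1 \<bullet> e1) * (z \<bullet> e2) - (e1 \<bullet> e2) * (z \<bullet> e1)) / gram M c p) *\<^sub>R axis 2 1)"

definition nhess :: "'a surface \<Rightarrow> 'a chart \<Rightarrow> real^2 \<Rightarrow> real^2 \<Rightarrow> real^2 \<Rightarrow> real^4" where
  "nhess M c p w v = hess M c p w v - frame M c p (coef M c p (hess M c p w v))"

lemma vec2_expand: "w = (w $ 1) *\<^sub>R axis 1 1 + (w $ 2) *\<^sub>R (axis 2 1 :: real^2)"
  by (simp add: vec_eq_iff forall_2 axis_def)

lemma linear_expand: "linear f \<Longrightarrow> f w = (w $ 1) *\<^sub>R f (axis 1 1) + (w $ 2) *\<^sub>R f (axis 2 1 :: real^2)"
  by (subst vec2_expand[of w]) (simp only: linear_add linear_scale)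

context
  fixes M :: "'a surface" and c :: "'a chart"
  assumes M: "immersed_surface M" and c: "c \<in> charts M"
begin

lemma open_chart_domain: "open (snd c ` fst c)" using chart_facts(2)[OF M c] .

lemma linear_frame: "p \<in> snd c ` fst c \<Longrightarrow> linear (frame M c p)"
  unfolding frame_def[abs_def] using smooth_on_differentiable[OF chart_facts(6)[OF M c]]
  by (simp add: linear_frechet_derivative)

lemma inj_frame: "p \<in> snd c ` fst c \<Longrightarrow> inj (frame M c p)"
  using chart_facts(7)[OF M c] unfolding chart_deriv_def frame_def by auto

lemma smooth_frame: "smooth_on (snd c ` fst c) (\<lambda>p. frame M c p w)"
  unfolding frame_def using smooth_on_frechet_derivative[OF chart_facts(6)[OF M c]] .

lemma smooth_hess: "smooth_on (snd c ` fst c) (\<lambda>p. hess M c p w v)"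
  unfolding hess_def using smooth_on_frechet_derivative[OF smooth_frame] .

lemma diff_frame: "p \<in> snd c ` fst c \<Longrightarrow> (\<lambda>p. frame M c p w) differentiable (at p)"
  using smooth_on_differentiable[OF smooth_frame] .

lemma diff_hess: "p \<in> snd c ` fst c \<Longrightarrow> (\<lambda>p. hess M c p w v) differentiable (at p)"
  using smooth_on_differentiable[OF smooth_hess] .

lemma gram_nz: assumes "p \<in> snd c ` fst c" shows "gram M c p \<noteq> 0"
proof
  assume 0: "gram M c p = 0"
  let ?e1 = "frame M c p (axis 1 1)" and ?e2 = "frame M c p (axis 2 1)"
  note l = linear_frame[OF assms] and i = inj_frame[OF assms]
  have k: "w = 0" if "frame M c p w = 0" for w
    using i l that by (metis injD linear_0)
  have e2: "?e2 \<noteq> 0" using k[of "axis 2 1"] by auto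
  let ?w = "(?e2 \<bullet> ?e2) *\<^sub>R axis 1 1 - (?e1 \<bullet> ?e2) *\<^sub>R axis 2 1 :: real^2"
  have f: "frame M c p ?w = (?e2 \<bullet> ?e2) *\<^sub>R ?e1 - (?e1 \<bullet> ?e2) *\<^sub>R ?e2"
    using l by (simp add: linear_diff linear_scale)
  have "frame M c p ?w \<bullet> frame M c p ?w = (?e2 \<bullet> ?e2) * gram M c p"
    unfolding f gram_def
    by (simp add: inner_diff_left inner_diff_right inner_commute[of ?e2 ?e1] algebra_simps power2_eq_square)
  then have "frame M c p ?w = 0" using 0 by simp
  then have "?w = 0" using k by blast
  then have "?w $ 1 = 0" by simp
  then have "?e2 \<bullet> ?e2 = 0" by (simp add: axis_def)
  then show False using e2 by simp
qed

lemma frame_perp: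
  assumes "p \<in> snd c ` fst c" shows "(z - frame M c p (coef M c p z)) \<bullet> frame M c p w = 0"
proof -
  let ?e1 = "frame M c p (axis 1 1)" and ?e2 = "frame M c p (axis 2 1)"
  note l = linear_frame[OF assms] and g = gram_nz[OF assms]
  have f: "frame M c p (coef M c p z) = 
    (((?e2 \<bullet> ?e2) * (z \<bullet> ?e1) - (?e1 \<bullet> ?e2) * (z \<bullet> ?e2)) / gram M c p) *\<^sub>R ?e1 +
     (((?e1 \<bullet> ?e1) * (z \<bullet> ?e2) - (?e1 \<bullet> ?e2) * (z \<bullet> ?e1)) / gram M c p) *\<^sub>R ?e2"
    unfolding coef_def Let_def using l by (simp add: linear_add linear_scale)
  have alg: "x - ((b * x - k * y) / d * a + (a * y - k * x) / d * k) = 0"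
    "y - ((b * x - k * y) / d * k + (a * y - k * x) / d * b) = 0"
    if "d = a * b - k\<^sup>2" "d \<noteq> 0" for a b k d x y :: real
  proof -
    have "(b * x - k * y) / d * a + (a * y - k * x) / d * k = (d * x) / d"
      unfolding that(1) by (simp add: add_divide_distrib[symmetric] algebra_simps power2_eq_square)
    moreover have "(b * x - k * y) / d * k + (a * y - k * x) / d * b = (d * y) / d"
      unfolding that(1) by (simp add: add_divide_distrib[symmetric] algebra_simps power2_eq_square)
    ultimately show "x - ((b * x - k * y) / d * a + (a * y - k * x) / d * k) = 0"
      "y - ((b * x - k * y) / d * k + (a * y - k * x) / d * b) = 0" using that(2) by auto
  qed
  have 1: "(z - frame M c p (coef M c p z)) \<bullet> ?e1 = 0"
    using alg(1)[OF gram_def g] unfolding f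
    by (simp only: inner_diff_left inner_add_left inner_scaleR_left inner_commute[of ?e2 ?e1])
  have 2: "(z - frame M c p (coef M c p z)) \<bullet> ?e2 = 0"
    using alg(2)[OF gram_def g] unfolding f
    by (simp only: inner_diff_left inner_add_left inner_scaleR_left inner_commute[of ?e2 ?e1])
  show ?thesis unfolding linear_expand[OF l, of w] inner_add_right inner_scaleR_right 1 2 by simp
qed

lemma chart_deriv_frame: "chart_deriv c (imm M) q w = frame M c (snd c q) w"
  by (simp add: chart_deriv_def frame_def)

lemma tangential_frame:
  assumes "q \<in> fst c"
  shows "tangential M q z = frame M c (snd c q) (coef M c (snd c q) z)"
proof -
  have q: "q \<in> topspace (points M)" using chart_facts(4)[OF M c] assms by blast
  have T: "tangent_plane M q = range (frame M c (snd c q))"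
    using tangent_plane_eq[OF M c assms] unfolding chart_deriv_frame .
  show ?thesis
    apply (rule tangential_normal(3)[OF M q])
    using frame_perp[of "snd c q"] assms unfolding normal_plane_def orthogonal_comp_def T orthogonal_def
    by (auto simp: inner_commute)
qed

lemma linear_coef: "linear (coef M c p)"
proof -
  have l: "linear (\<lambda>z. (a * (z \<bullet> b) - k * (z \<bullet> e)) / d)" for a k d :: real and b e :: "real^4"
  proof (rule linearI)
    fix x y :: "real^4" and r :: real
    have "a * ((x + y) \<bullet> b) - k * ((x + y) \<bullet> e) = (a * (x \<bullet> b) - k * (x \<bullet> e)) + (a * (y \<bullet> b) - k * (y \<bullet> e))"
      by (simp add: inner_add_left distrib_left)
    then show "(a * ((x + y) \<bullet> b) - k * ((x + y) \<bullet> e)) / d = (a * (x \<bullet> b) - k * (x \<bullet> e)) / d + (a * (y \<bullet> b) - k * (y \<bullet> e)) / d"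
      by (simp only: add_divide_distrib)
    have "a * ((r *\<^sub>R x) \<bullet> b) - k * ((r *\<^sub>R x) \<bullet> e) = r * (a * (x \<bullet> b) - k * (x \<bullet> e))"
      by (simp add: algebra_simps)
    then show "(a * ((r *\<^sub>R x) \<bullet> b) - k * ((r *\<^sub>R x) \<bullet> e)) / d = r *\<^sub>R ((a * (x \<bullet> b) - k * (x \<bullet> e)) / d)"
      by simp
  qed
  have s: "linear (\<lambda>z. f z *\<^sub>R u)" if "linear f" for f :: "real^4 \<Rightarrow> real" and u :: "real^2"
    using that by (intro linearI) (simp_all add: linear_add linear_scale scaleR_add_left)
  show ?thesis unfolding coef_def[abs_def] Let_def
    by (intro linear_compose_add s l)
qed

lemma coef_frame: assumes "p \<in> snd c ` fst c" shows "coef M c p (frame M c p w) = w"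
proof -
  let ?d = "frame M c p w - frame M c p (coef M c p (frame M c p w))"
  have "?d = frame M c p (w - coef M c p (frame M c p w))" 
    by (rule linear_diff[OF linear_frame[OF assms], symmetric])
  then have "?d \<bullet> ?d = ?d \<bullet> frame M c p (w - coef M c p (frame M c p w))" by (rule arg_cong)
  then have "?d \<bullet> ?d = 0" using frame_perp[OF assms] by simp
  then have "frame M c p w = frame M c p (coef M c p (frame M c p w))" by simp
  then show ?thesis using injD[OF inj_frame[OF assms]] by metis
qed

lemma diff_coef:
  assumes "p \<in> snd c ` fst c" "z differentiable (at p)"
  shows "(\<lambda>p. coef M c p (z p)) differentiable (at p)"
  unfolding coef_def Let_def using gram_nz[OF assms(1)] assms(2) diff_frame[OF assms(1)] unfolding gram_def
  by (intro differentiable_add differentiable_scaleR differentiable_divide differentiable_diff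
    differentiable_mult differentiable_inner differentiable_const differentiable_power) auto

lemma frame_field:
  assumes p: "p \<in> snd c ` fst c" and a: "(a has_derivative a') (at p)"
  shows "((\<lambda>p. frame M c p (a p)) has_derivative (\<lambda>v. frame M c p (a' v) + hess M c p (a p) v)) (at p)"
proof -
  have d: "((\<lambda>p. frame M c p w) has_derivative (\<lambda>v. hess M c p w v)) (at p)" for w
    unfolding hess_def using diff_frame[OF p] frechet_derivative_works by blast
  have aw: "((\<lambda>p. a p $ i) has_derivative (\<lambda>v. a' v $ i)) (at p)" for i
    using bounded_linear.has_derivative[OF bounded_linear_vec_nth a] .
  have h: "hess M c p w v = (w$1) *\<^sub>R hess M c p (axis 1 1) v + (w$2) *\<^sub>R hess M c p (axis 2 1) v" for w v
  proof -
    have "((\<lambda>p. (w$1) *\<^sub>R frame M c p (axis 1 1) + (w$2) *\<^sub>R frame M c p (axis 2 1)) has_derivative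
       (\<lambda>v. (w$1) *\<^sub>R hess M c p (axis 1 1) v + (w$2) *\<^sub>R hess M c p (axis 2 1) v)) (at p)"
      by (intro derivative_intros d)
    then have "((\<lambda>p. frame M c p w) has_derivative
       (\<lambda>v. (w$1) *\<^sub>R hess M c p (axis 1 1) v + (w$2) *\<^sub>R hess M c p (axis 2 1) v)) (at p)"
      by (rule has_derivative_transform_within_open[OF _ open_chart_domain p])
         (rule linear_expand[OF linear_frame, symmetric])
    from fun_cong[OF has_derivative_unique[OF d this], of v] show ?thesis .
  qed
  have "((\<lambda>p. (a p$1) *\<^sub>R frame M c p (axis 1 1) + (a p$2) *\<^sub>R frame M c p (axis 2 1)) has_derivative
      (\<lambda>v. ((a p$1) *\<^sub>R hess M c p (axis 1 1) v + (a' v $1) *\<^sub>R frame M c p (axis 1 1)) 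
         + ((a p$2) *\<^sub>R hess M c p (axis 2 1) v + (a' v $2) *\<^sub>R frame M c p (axis 2 1)))) (at p)"
    by (intro derivative_intros d aw)
  then have D: "((\<lambda>p. frame M c p (a p)) has_derivative
      (\<lambda>v. ((a p$1) *\<^sub>R hess M c p (axis 1 1) v + (a' v $1) *\<^sub>R frame M c p (axis 1 1)) 
         + ((a p$2) *\<^sub>R hess M c p (axis 2 1) v + (a' v $2) *\<^sub>R frame M c p (axis 2 1)))) (at p)"
    by (rule has_derivative_transform_within_open[OF _ open_chart_domain p]) (rule linear_expand[OF linear_frame, symmetric])
  have "frame M c p (a' v) + hess M c p (a p) v =
     ((a p$1) *\<^sub>R hess M c p (axis 1 1) v + (a' v $1) *\<^sub>R frame M c p (axis 1 1)) 
         + ((a p$2) *\<^sub>R hess M c p (axis 2 1) v + (a' v $2) *\<^sub>R frame M c p (axis 2 1))" for v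
    unfolding h[of "a p" v] linear_expand[OF linear_frame[OF p], of "a' v"] by simp
  then show ?thesis using D by simp
qed

lemma hess_linear1: assumes p: "p \<in> snd c ` fst c" shows "linear (\<lambda>w. hess M c p w v)"
proof -
  have d: "((\<lambda>p. frame M c p w) has_derivative (\<lambda>v. hess M c p w v)) (at p)" for w
    unfolding hess_def using diff_frame[OF p] frechet_derivative_works by blast
  have "hess M c p w = (\<lambda>v. (w$1) *\<^sub>R hess M c p (axis 1 1) v + (w$2) *\<^sub>R hess M c p (axis 2 1) v)" for w
  proof -
    have "((\<lambda>p. (w$1) *\<^sub>R frame M c p (axis 1 1) + (w$2) *\<^sub>R frame M c p (axis 2 1)) has_derivative
       (\<lambda>v. (w$1) *\<^sub>R hess M c p (axis 1 1) v + (w$2) *\<^sub>R hess M c p (axis 2 1) v)) (at p)"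
      by (intro derivative_intros d)
    then have "((\<lambda>p. frame M c p w) has_derivative
       (\<lambda>v. (w$1) *\<^sub>R hess M c p (axis 1 1) v + (w$2) *\<^sub>R hess M c p (axis 2 1) v)) (at p)"
      by (rule has_derivative_transform_within_open[OF _ open_chart_domain p])
         (rule linear_expand[OF linear_frame, symmetric])
    from has_derivative_unique[OF d this] show ?thesis .
  qed
  note h = fun_cong[OF this]
  show ?thesis
  proof (rule linearI)
    fix a b show "hess M c p (a + b) v = hess M c p a v + hess M c p b v"
      by (simp add: h[of a] h[of b] h[of "a + b"] algebra_simps)
  next
    fix r b show "hess M c p (r *\<^sub>R b) v = r *\<^sub>R hess M c p b v"
      by (simp add: h[of b] h[of "r *\<^sub>R b"] algebra_simps)
  qed
qed

lemma hess_linear2: assumes p: "p \<in> snd c ` fst c" shows "linear (hess M c p w)"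
  unfolding hess_def[abs_def] using diff_frame[OF p] by (simp add: linear_frechet_derivative)

lemma nhess_linear1: assumes p: "p \<in> snd c ` fst c" shows "linear (\<lambda>w. nhess M c p w v)"
  unfolding nhess_def
  by (intro linear_compose_sub hess_linear1[OF p] 
    linear_compose[OF linear_compose[OF hess_linear1[OF p] linear_coef] linear_frame[OF p], unfolded o_def])

lemma nhess_linear2: assumes p: "p \<in> snd c ` fst c" shows "linear (nhess M c p w)"
  unfolding nhess_def[abs_def]
  by (intro linear_compose_sub hess_linear2[OF p] 
    linear_compose[OF linear_compose[OF hess_linear2[OF p] linear_coef] linear_frame[OF p], unfolded o_def])

lemma diff_nhess: assumes "p \<in> snd c ` fst c" shows "(\<lambda>p. nhess M c p w v) differentiable (at p)"
proof -
  have "(\<lambda>p. coef M c p (hess M c p w v)) differentiable (at p)" 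
    by (rule diff_coef[OF assms diff_hess[OF assms]])
  then obtain a' where "((\<lambda>p. coef M c p (hess M c p w v)) has_derivative a') (at p)"
    unfolding differentiable_def by blast
  from frame_field[OF assms this] show ?thesis unfolding nhess_def
    using diff_hess[OF assms] differentiableI differentiable_diff by blast
qed

lemma nhess_field:
  assumes p: "p \<in> snd c ` fst c" and z: "(z has_derivative z') (at p)" and y: "(y has_derivative y') (at p)"
  shows "((\<lambda>p. nhess M c p (z p) (y p)) has_derivative
    (\<lambda>v. nhess M c p (z' v) (y p) + nhess M c p (z p) (y' v) + 
      (\<Sum>i\<in>{1,2}. \<Sum>j\<in>{1,2}. (z p $ i * y p $ j) *\<^sub>R frechet_derivative (\<lambda>p. nhess M c p (axis i 1) (axis j 1)) (at p) v))) (at p)"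
proof -
  have ex: "nhess M c p a b = (\<Sum>i\<in>{1,2}. \<Sum>j\<in>{1,2}. (a $ i * b $ j) *\<^sub>R nhess M c p (axis i 1) (axis j 1))"
    if "p \<in> snd c ` fst c" for p a b
    unfolding linear_expand[OF nhess_linear1[OF that], of a] 
      linear_expand[OF nhess_linear2[OF that, of "axis 1 1"], of b]
      linear_expand[OF nhess_linear2[OF that, of "axis 2 1"], of b]
    by (simp add: scaleR_add_right)
  have d: "((\<lambda>p. nhess M c p (axis i 1) (axis j 1)) has_derivative 
     frechet_derivative (\<lambda>p. nhess M c p (axis i 1) (axis j 1)) (at p)) (at p)" for i j
    using diff_nhess[OF p] frechet_derivative_works by blast
  have zw: "((\<lambda>p. z p $ i) has_derivative (\<lambda>v. z' v $ i)) (at p)" for i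
    using bounded_linear.has_derivative[OF bounded_linear_vec_nth z] .
  have yw: "((\<lambda>p. y p $ i) has_derivative (\<lambda>v. y' v $ i)) (at p)" for i
    using bounded_linear.has_derivative[OF bounded_linear_vec_nth y] .
  have "((\<lambda>p. \<Sum>i\<in>{1,2}. \<Sum>j\<in>{1,2}. (z p $ i * y p $ j) *\<^sub>R nhess M c p (axis i 1) (axis j 1)) has_derivative
     (\<lambda>v. \<Sum>i\<in>{1,2}. \<Sum>j\<in>{1,2}. ((z p $ i * y p $ j) *\<^sub>R frechet_derivative (\<lambda>p. nhess M c p (axis i 1) (axis j 1)) (at p) v
       + (z p $ i * y' v $ j + z' v $ i * y p $ j) *\<^sub>R nhess M c p (axis i 1) (axis j 1)))) (at p)"
    by (intro derivative_intros d zw yw)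
  then have "((\<lambda>p. nhess M c p (z p) (y p)) has_derivative
     (\<lambda>v. \<Sum>i\<in>{1,2}. \<Sum>j\<in>{1,2}. ((z p $ i * y p $ j) *\<^sub>R frechet_derivative (\<lambda>p. nhess M c p (axis i 1) (axis j 1)) (at p) v
       + (z p $ i * y' v $ j + z' v $ i * y p $ j) *\<^sub>R nhess M c p (axis i 1) (axis j 1)))) (at p)"
    by (rule has_derivative_transform_within_open[OF _ open_chart_domain p]) (rule ex[symmetric])
  moreover have "(\<Sum>i\<in>{1,2}. \<Sum>j\<in>{1,2}. ((z p $ i * y p $ j) *\<^sub>R frechet_derivative (\<lambda>p. nhess M c p (axis i 1) (axis j 1)) (at p) v
       + (z p $ i * y' v $ j + z' v $ i * y p $ j) *\<^sub>R nhess M c p (axis i 1) (axis j 1)))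
     = nhess M c p (z' v) (y p) + nhess M c p (z p) (y' v) + 
      (\<Sum>i\<in>{1,2}. \<Sum>j\<in>{1,2}. (z p $ i * y p $ j) *\<^sub>R frechet_derivative (\<lambda>p. nhess M c p (axis i 1) (axis j 1)) (at p) v)" for v
    unfolding ex[OF p, of "z' v" "y p"] ex[OF p, of "z p" "y' v"]
    by (simp add: scaleR_add_left scaleR_add_right)
  ultimately show ?thesis by (simp only:)
qed


lemma normal_frame:
  assumes "q \<in> fst c" shows "normal M q (frame M c (snd c q) w) = 0"
  unfolding normal_def tangential_frame[OF assms] using coef_frame[of "snd c q"] assms by simp

lemma normal_nhess:
  assumes "q \<in> fst c" shows "normal M q (hess M c (snd c q) w v) = nhess M c (snd c q) w v"
  unfolding normal_def tangential_frame[OF assms] nhess_def ..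

lemma normal_linear:
  assumes "q \<in> fst c" shows "linear (normal M q)"
proof -
  have p: "snd c q \<in> snd c ` fst c" using assms by simp
  show ?thesis unfolding normal_def[abs_def] tangential_frame[OF assms]
    by (intro linear_compose_sub linear_id[unfolded id_def] 
     linear_compose[OF linear_coef linear_frame[OF p], unfolded o_def])
qed

lemma normal_nhess2:
  assumes "q \<in> fst c" shows "normal M q (nhess M c (snd c q) w v) = nhess M c (snd c q) w v"
  unfolding nhess_def linear_diff[OF normal_linear[OF assms]] normal_frame[OF assms]
   normal_nhess[OF assms] by (simp add: nhess_def)

definition "is_field P X a \<longleftrightarrow> (\<forall>p\<in>P. in_chart c X p = frame M c p (a p))"

lemma field_dir_deriv:
  assumes P: "open P" "P \<subseteq> snd c ` fst c" "q \<in> fst c" "snd c q \<in> P"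
   and Y: "\<And>p. p \<in> P \<Longrightarrow> in_chart c Y p = y p" "(y has_derivative y') (at (snd c q))"
   and X: "X = frame M c (snd c q) v"
  shows "dir_deriv M q X Y = y' v"
proof -
  have d: "(in_chart c Y has_derivative y') (at (snd c q))"
    by (rule has_derivative_transform_within_open[OF Y(2) P(1,4)]) (simp add: Y(1))
  then have e: "chart_deriv c Y q = y'" unfolding chart_deriv_def by (rule frechet_derivative_at[symmetric])
  show ?thesis unfolding X chart_deriv_frame[symmetric]
    dir_deriv_eq[OF M c P(3) differentiableI[OF d]] e ..
qed

lemma second_ff_coords:
  assumes P: "open P" "P \<subseteq> snd c ` fst c" "q \<in> fst c" "snd c q \<in> P"
   and Y: "is_field P Y a" "(a has_derivative a') (at (snd c q))"
   and X: "X q = frame M c (snd c q) v"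
  shows "second_ff_field M X Y q = nhess M c (snd c q) (a (snd c q)) v"
    "tangent_conn M X Y q = frame M c (snd c q) (a' v + coef M c (snd c q) (hess M c (snd c q) (a (snd c q)) v))"
proof -
  have p: "snd c q \<in> snd c ` fst c" using P by blast
  have d: "dir_deriv M q (X q) Y = frame M c (snd c q) (a' v) + hess M c (snd c q) (a (snd c q)) v"
    by (rule field_dir_deriv[OF P _ frame_field[OF p Y(2)] X]) (use Y(1) in \<open>simp add: is_field_def\<close>)
  show "second_ff_field M X Y q = nhess M c (snd c q) (a (snd c q)) v"
    unfolding second_ff_field_def d linear_add[OF normal_linear[OF P(3)]] normal_frame[OF P(3)]
      normal_nhess[OF P(3)] by simp
  show "tangent_conn M X Y q = frame M c (snd c q) (a' v + coef M c (snd c q) (hess M c (snd c q) (a (snd c q)) v))"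
    unfolding tangent_conn_def d tangential_frame[OF P(3)] linear_add[OF linear_coef] coef_frame[OF p] ..
qed

lemma in_chartD: "is_field P X a \<Longrightarrow> q \<in> fst c \<Longrightarrow> snd c q \<in> P \<Longrightarrow> X q = frame M c (snd c q) (a (snd c q))"
  unfolding is_field_def using in_chart_eq[OF M c, of q X] by auto

lemma in_chartI: "P \<subseteq> snd c ` fst c \<Longrightarrow> (\<And>q. q \<in> fst c \<Longrightarrow> snd c q \<in> P \<Longrightarrow> X q = y (snd c q)) \<Longrightarrow> p \<in> P \<Longrightarrow> in_chart c X p = y p"
  using in_chart_eq[OF M c, where h=X] by (auto dest!: subsetD)

definition "cov_coords p x y z = (\<Sum>i\<in>{1,2}. \<Sum>j\<in>{1,2}. (z $ i * y $ j) *\<^sub>R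
      frechet_derivative (\<lambda>p. nhess M c p (axis i 1) (axis j 1)) (at p) x)"

lemma conn_diff:
  assumes "p \<in> P" "P \<subseteq> snd c ` fst c" "open P" "smooth_on P x" "smooth_on P y"
  shows "(\<lambda>p. frechet_derivative y (at p) (x p) + coef M c p (hess M c p (y p) (x p))) differentiable (at p)"
proof -
  have p: "p \<in> snd c ` fst c" using assms by blast
  have xd: "x differentiable (at p)" and yd: "y differentiable (at p)"
    using assms smooth_on_differentiable by blast+
  have xi: "(\<lambda>p. x p $ i) differentiable (at p)" and yi: "(\<lambda>p. y p $ i) differentiable (at p)" for i
    using xd yd unfolding differentiable_def
    by (auto intro: bounded_linear.has_derivative[OF bounded_linear_vec_nth])
  have 1: "(\<lambda>p. frechet_derivative y (at p) (x p)) differentiable (at p)"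
  proof -
    have "(\<lambda>p. (x p $ 1) *\<^sub>R frechet_derivative y (at p) (axis 1 1) + (x p $ 2) *\<^sub>R frechet_derivative y (at p) (axis 2 1)) differentiable (at p)"
      by (intro differentiable_add differentiable_scaleR xi 
        smooth_on_differentiable[OF smooth_on_frechet_derivative[OF assms(5)] assms(1)])
    then obtain D where "((\<lambda>p. (x p $ 1) *\<^sub>R frechet_derivative y (at p) (axis 1 1) + (x p $ 2) *\<^sub>R frechet_derivative y (at p) (axis 2 1)) has_derivative D) (at p)"
      unfolding differentiable_def by blast
    then have "((\<lambda>p. frechet_derivative y (at p) (x p)) has_derivative D) (at p)"
    proof (rule has_derivative_transform_within_open[OF _ assms(3,1)])
      fix p' assume "p' \<in> P"
      note l = linear_frechet_derivative[OF smooth_on_differentiable[OF assms(5) this]]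
      show "(x p' $ 1) *\<^sub>R frechet_derivative y (at p') (axis 1 1) + (x p' $ 2) *\<^sub>R frechet_derivative y (at p') (axis 2 1)
        = frechet_derivative y (at p') (x p')"
        unfolding linear_expand[OF l, of "x p'"] ..
    qed
    then show ?thesis by (rule differentiableI)
  qed
  have 2: "(\<lambda>p. hess M c p (y p) (x p)) differentiable (at p)"
  proof -
    let ?h = "\<lambda>p. (y p $ 1) *\<^sub>R ((x p $ 1) *\<^sub>R hess M c p (axis 1 1) (axis 1 1) + (x p $ 2) *\<^sub>R hess M c p (axis 1 1) (axis 2 1)) +
       (y p $ 2) *\<^sub>R ((x p $ 1) *\<^sub>R hess M c p (axis 2 1) (axis 1 1) + (x p $ 2) *\<^sub>R hess M c p (axis 2 1) (axis 2 1))"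
    have "?h differentiable (at p)"
      by (intro differentiable_add differentiable_scaleR xi yi diff_hess[OF p])
    then obtain D where D: "(?h has_derivative D) (at p)"
      unfolding differentiable_def by blast
    have "((\<lambda>p. hess M c p (y p) (x p)) has_derivative D) (at p)"
    proof (rule has_derivative_transform_within_open[OF D open_chart_domain p])
      fix p' assume p': "p' \<in> snd c ` fst c"
      show "?h p' = hess M c p' (y p') (x p')"
        unfolding linear_expand[OF hess_linear1[OF p'], of "y p'"] 
          linear_expand[OF hess_linear2[OF p', of "axis 1 1"], of "x p'"]
          linear_expand[OF hess_linear2[OF p', of "axis 2 1"], of "x p'"] ..
    qed
    then show ?thesis by (rule differentiableI)
  qed
  show ?thesis by (rule differentiable_add[OF 1 diff_coef[OF p 2]])
qed

lemma cov_coords: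
  assumes P: "open P" "P \<subseteq> snd c ` fst c" "q \<in> fst c" "snd c q \<in> P"
   and F: "is_field P X x" "is_field P Y y" "is_field P Z z"
   and s: "smooth_on P x" "smooth_on P y" "smooth_on P z"
  defines "p \<equiv> snd c q"
  shows "cov_deriv_second_ff_field M X Y Z q = normal M q (cov_coords p (x p) (y p) (z p))
    - nhess M c p (z p) (coef M c p (hess M c p (y p) (x p)))
    - nhess M c p (coef M c p (hess M c p (z p) (x p))) (y p)"
proof -
  have pU: "p \<in> snd c ` fst c" "p \<in> P" using P unfolding p_def by auto
  have D: "(f has_derivative frechet_derivative f (at p)) (at p)" if "smooth_on P f" "p \<in> P" for f :: "real^2 \<Rightarrow> real^2" and p
    using smooth_on_differentiable[OF that] frechet_derivative_works by blast
  note Xq = in_chartD[OF F(1)]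
  have "second_ff_field M Y Z q' = nhess M c (snd c q') (z (snd c q')) (y (snd c q'))"
    if "q' \<in> fst c" "snd c q' \<in> P" for q'
    by (rule second_ff_coords(1)[where X=Y and v="y (snd c q')", OF P(1,2) that F(3) D[OF s(3) that(2)] in_chartD[OF F(2) that]])
  note I = in_chartI[OF P(2), of "second_ff_field M Y Z" "\<lambda>p. nhess M c p (z p) (y p)", OF this]
  have d: "dir_deriv M q (X q) (second_ff_field M Y Z) =
     nhess M c p (frechet_derivative z (at p) (x p)) (y p) + nhess M c p (z p) (frechet_derivative y (at p) (x p))
     + cov_coords p (x p) (y p) (z p)"
    unfolding cov_coords_def p_def
    by (rule field_dir_deriv[OF P I nhess_field[OF pU(1)[unfolded p_def] D[OF s(3) P(4)] D[OF s(2) P(4)]] Xq[OF P(3,4)]])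
  have A: "normal_conn M X (second_ff_field M Y Z) q = 
     nhess M c p (frechet_derivative z (at p) (x p)) (y p) + nhess M c p (z p) (frechet_derivative y (at p) (x p))
     + normal M q (cov_coords p (x p) (y p) (z p))"
    unfolding normal_conn_def d linear_add[OF normal_linear[OF P(3)]]
    unfolding p_def normal_nhess2[OF P(3)] ..
  let ?w = "\<lambda>y p. frechet_derivative y (at p) (x p) + coef M c p (hess M c p (y p) (x p))"
  have T: "is_field P (tangent_conn M X Y) (?w y)" if "smooth_on P y" "is_field P Y y" for y Y
    unfolding is_field_def
  proof
    fix p' assume "p' \<in> P"
    then obtain q' where q': "q' \<in> fst c" "p' = snd c q'" "snd c q' \<in> P" using P(2) by blast
    have "tangent_conn M X Y q' = frame M c (snd c q') (?w y (snd c q'))"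
      by (rule second_ff_coords(2)[where X=X and v="x (snd c q')", OF P(1,2) q'(1,3) that(2) D[OF that(1) q'(3)] Xq[OF q'(1,3)]])
    then show "in_chart c (tangent_conn M X Y) p' = frame M c p' (?w y p')"
      unfolding q'(2) in_chart_eq[OF M c q'(1)] .
  qed
  have B: "second_ff_field M (tangent_conn M X Y) Z q = nhess M c p (z p) (?w y p)"
    unfolding p_def
    by (rule second_ff_coords(1)[where X="tangent_conn M X Y" and v="?w y (snd c q)", OF P F(3) D[OF s(3) P(4)] in_chartD[OF T[OF s(2) F(2)] P(3,4)]])
  have wd: "?w z differentiable (at (snd c q))"
    by (rule conn_diff[OF P(4,2,1) s(1,3)])
  have C: "second_ff_field M Y (tangent_conn M X Z) q = nhess M c p (?w z p) (y p)"
    unfolding p_def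
    by (rule second_ff_coords(1)[where X=Y and v="y (snd c q)", OF P T[OF s(3) F(3)] _ in_chartD[OF F(2) P(3,4)]])
      (rule wd[unfolded frechet_derivative_works])
  show ?thesis unfolding cov_deriv_second_ff_field_def A B C 
    linear_add[OF nhess_linear1[OF pU(1)]] linear_add[OF nhess_linear2[OF pU(1)]] by simp
qed

end


section \<open>Independence of the extension\<close>

lemma smooth_on_const: "smooth_on S (\<lambda>_. a)"
proof -
  have "Ck_on k S (\<lambda>_. a)" for k
    by (induction k arbitrary: a) simp_all
  then show ?thesis by (simp add: smooth_on_def)
qed

lemma tangent_field_extend:
  assumes M: "immersed_surface M" and m: "m \<in> topspace (points M)" and x: "x \<in> tangent_plane M m"
  shows "is_field M (chart_at M m) (snd (chart_at M m) ` fst (chart_at M m)) (extend M m x) (\<lambda>_. coords M m x)"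
    and "extend M m x m = x"
    and "x = frame M (chart_at M m) (snd (chart_at M m) m) (coords M m x)"
proof -
  note c = chart_at[OF M m]
  show "is_field M (chart_at M m) (snd (chart_at M m) ` fst (chart_at M m)) (extend M m x) (\<lambda>_. coords M m x)"
    unfolding is_field_def[OF M c[THEN conjunct1]] 
    by (auto simp: extend_def in_chart_eq[OF M c[THEN conjunct1]] chart_deriv_frame[OF M c[THEN conjunct1]])
  show e: "extend M m x m = x" unfolding extend_def coords_def
    by (rule f_inv_into_f) (use x in \<open>simp add: tangent_plane_def\<close>)
  show "x = frame M (chart_at M m) (snd (chart_at M m) m) (coords M m x)"
    using e chart_deriv_frame[OF M c[THEN conjunct1]] by (simp add: extend_def)
qed

lemma tensors_eq:
  assumes M: "immersed_surface M" and m: "m \<in> topspace (points M)"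
    and X: "tangent_field_near M m X" and Y: "tangent_field_near M m Y" and Z: "tangent_field_near M m Z"
  shows second_ff_field_eq: "second_ff_field M X Y m = second_ff M m (X m) (Y m)"
    and cov_deriv_second_ff_field_eq:
      "cov_deriv_second_ff_field M X Y Z m = cov_deriv_second_ff M m (X m) (Y m) (Z m)"
proof -
  define c where "c = chart_at M m"
  let ?U = "snd c ` fst c"
  have c: "c \<in> charts M" and mc: "m \<in> fst c" using chart_at[OF M m] unfolding c_def by auto
  have fd: "is_field M c P W a \<longleftrightarrow> (\<forall>p\<in>P. in_chart c W p = frechet_derivative (in_chart c (imm M)) (at p) (a p))"
    for P W a unfolding is_field_def[OF M c] frame_def ..
  have mono: "is_field M c P W a \<Longrightarrow> Q \<subseteq> P \<Longrightarrow> is_field M c Q W a" for P Q W a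
    unfolding fd by blast
  obtain P1 x where 1: "open P1" "snd c m \<in> P1" "P1 \<subseteq> ?U" "smooth_on P1 x" "is_field M c P1 X x"
    using X unfolding tangent_field_near_def c_def[symmetric] Let_def fd[symmetric] by blast
  obtain P2 y where 2: "open P2" "snd c m \<in> P2" "P2 \<subseteq> ?U" "smooth_on P2 y" "is_field M c P2 Y y"
    using Y unfolding tangent_field_near_def c_def[symmetric] Let_def fd[symmetric] by blast
  obtain P3 z where 3: "open P3" "snd c m \<in> P3" "P3 \<subseteq> ?U" "smooth_on P3 z" "is_field M c P3 Z z"
    using Z unfolding tangent_field_near_def c_def[symmetric] Let_def fd[symmetric] by blast
  define P where "P = P1 \<inter> P2 \<inter> P3"
  have P: "open P" "P \<subseteq> ?U" "m \<in> fst c" "snd c m \<in> P" using 1 2 3 mc unfolding P_def by auto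
  have sub: "P \<subseteq> P1" "P \<subseteq> P2" "P \<subseteq> P3" unfolding P_def by auto
  have F: "is_field M c P X x" "is_field M c P Y y" "is_field M c P Z z"
    using 1(5) 2(5) 3(5) mono sub by blast+
  have s: "smooth_on P x" "smooth_on P y" "smooth_on P z"
    using 1(4) 2(4) 3(4) sub Ck_on_open_mono unfolding smooth_on_def by blast+
  note E = in_chartD[OF M c]
  have T: "W m \<in> tangent_plane M m \<and> coords M m (W m) = a (snd c m)" if "is_field M c P W a" for W a
  proof -
    have "W m = chart_deriv c (imm M) m (a (snd c m))"
      using E[OF that mc P(4)] chart_deriv_frame[OF M c] by simp
    then show ?thesis unfolding tangent_plane_def coords_def c_def[symmetric]
      using chart_facts(7)[OF M c mc] by (simp add: inv_f_f)
  qed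
  have G: "is_field M c P (extend M m (W m)) (\<lambda>_. a (snd c m))" "extend M m (W m) m = W m"
    "W m = frame M c (snd c m) (a (snd c m))"
    if "is_field M c P W a" for W a
    using tangent_field_extend[OF M m, of "W m"] T[OF that] mono[OF _ P(2)] unfolding c_def[symmetric] by auto
  have yd: "(y has_derivative frechet_derivative y (at (snd c m))) (at (snd c m))"
    using smooth_on_differentiable[OF s(2) P(4)] frechet_derivative_works by blast
  have "second_ff_field M X Y m = nhess M c (snd c m) (y (snd c m)) (x (snd c m))"
    by (rule second_ff_coords(1)[OF M c P F(2) yd, where X=X and v="x (snd c m)", OF G(3)[OF F(1)]])
  moreover have "second_ff M m (X m) (Y m) = nhess M c (snd c m) (y (snd c m)) (x (snd c m))"
    unfolding second_ff_def
    by (rule second_ff_coords(1)[OF M c P G(1)[OF F(2)] has_derivative_const, 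
          where X="extend M m (X m)" and v="x (snd c m)"])
      (rule trans[OF G(2)[OF F(1)] G(3)[OF F(1)]])
  ultimately show "second_ff_field M X Y m = second_ff M m (X m) (Y m)" by simp
  show "cov_deriv_second_ff_field M X Y Z m = cov_deriv_second_ff M m (X m) (Y m) (Z m)"
    unfolding cov_deriv_second_ff_def cov_coords[OF M c P F s]
      cov_coords[OF M c P G(1)[OF F(1)] G(1)[OF F(2)] G(1)[OF F(3)] smooth_on_const smooth_on_const smooth_on_const] ..
qed


end

theory Submission
  imports Defs
begin

text \<open>Let \<open>u\<close> determine a rib direction along \<open>x\<close>. Being normal, \<open>u\<close> has no tangential part, so the
  terms of \<open>d3\<close> in \<open>u \<bullet> x\<close> and in the tangential part of \<open>u\<close> vanish. The second order condition says that
  \<open>u \<bullet> \<alpha>(x, y) = x \<bullet> y\<close> for all tangent vectors \<open>y\<close>. Its cases \<open>y = x\<close> and \<open>y = J x\<close> are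
  \<open>u \<bullet> \<alpha>(x, x) = x \<bullet> x \<noteq> 0\<close> and \<open>u \<bullet> \<alpha>(x, J x) = 0\<close>. The first one also cancels the second order
  terms of \<open>d3\<close>, so the vanishing of \<open>d3\<close> reduces to
  \<open>u \<bullet> (\<nabla>\<^sub>x\<alpha>)(x, x) = 0\<close> (\<open>rib_direction_orthogonal_cov_deriv\<close>).

  The rest is linear algebra in the normal plane, where all these vectors lie. The vectors
  \<open>\<alpha>(x, J x)\<close> and \<open>(\<nabla>\<^sub>x\<alpha>)(x, x)\<close> are both orthogonal to \<open>u \<noteq> 0\<close>, hence proportional
  (\<open>plane_det_eq_0\<close>). If \<open>J \<alpha>(x, x) \<bullet> \<alpha>(x, J x)\<close> vanishes, then \<open>\<alpha>(x, J x)\<close> is a multiple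
  of \<open>\<alpha>(x, x)\<close>, which is nonzero. As \<open>\<alpha>(x, x)\<close>
  is not orthogonal to \<open>u\<close> while \<open>\<alpha>(x, J x)\<close> is, that multiple is zero
  (\<open>plane_det_eq_0_imp_zero\<close>).\<close>

lemma orthonormal_basis_expand:
  assumes "orthonormal_basis P e1 e2" "v \<in> P"
  shows "v = (v \<bullet> e1) *\<^sub>R e1 + (v \<bullet> e2) *\<^sub>R e2"
proof -
  have n: "e1 \<bullet> e1 = 1" "e2 \<bullet> e2 = 1" "e1 \<bullet> e2 = 0" "e2 \<bullet> e1 = 0"
    using assms(1) by (auto simp: orthonormal_basis_def orthogonal_def norm_eq_1 inner_commute)
  have "v \<in> span {e1, e2}" using assms by (simp add: orthonormal_basis_def)
  then obtain a b where "v - a *\<^sub>R e1 = b *\<^sub>R e2"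
    by (auto simp: span_breakdown_eq span_singleton)
  then have v: "v = a *\<^sub>R e1 + b *\<^sub>R e2" by (simp add: algebra_simps)
  have "v \<bullet> e1 = a" "v \<bullet> e2 = b" unfolding v by (simp_all add: inner_add_left n)
  with v show ?thesis by simp
qed

lemma orthonormal_basis_inner:
  assumes "orthonormal_basis P e1 e2" "v \<in> P"
  shows "v \<bullet> w = (v \<bullet> e1) * (w \<bullet> e1) + (v \<bullet> e2) * (w \<bullet> e2)"
  by (subst orthonormal_basis_expand[OF assms])
    (simp add: inner_add_left inner_commute[of w])

lemma plane_det_expand: "plane_det e1 e2 v w = (v \<bullet> e1) * (w \<bullet> e2) - (v \<bullet> e2) * (w \<bullet> e1)"
  by (simp add: plane_det_def det_2)

lemma rotation90_on_inner:
  assumes "rotation90_on P J" "v \<in> P"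
  obtains e1 e2 where "orthonormal_basis P e1 e2" "J v \<in> P"
    "\<And>w. J v \<bullet> w = plane_det e1 e2 v w"
proof -
  obtain e1 e2 where e: "orthonormal_basis P e1 e2"
    and J: "\<And>a b. J (a *\<^sub>R e1 + b *\<^sub>R e2) = a *\<^sub>R e2 - b *\<^sub>R e1"
    using assms(1) unfolding rotation90_on_def by blast
  have Jv: "J v = (v \<bullet> e1) *\<^sub>R e2 - (v \<bullet> e2) *\<^sub>R e1"
    using J orthonormal_basis_expand[OF e assms(2)] by metis
  have "J v \<in> span {e1, e2}"
    unfolding Jv by (intro span_diff span_scale span_base) auto
  then have "J v \<in> P" using e by (simp add: orthonormal_basis_def)
  moreover have "J v \<bullet> w = plane_det e1 e2 v w" for w
    unfolding Jv plane_det_expand by (simp add: inner_diff_left inner_commute[of w])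
  ultimately show thesis using that e by blast
qed

lemma rotation90_on_orthogonal:
  assumes "rotation90_on P J" "v \<in> P"
  shows "J v \<in> P" "v \<bullet> J v = 0"
proof -
  obtain e1 e2 where "J v \<in> P" "\<And>w. J v \<bullet> w = plane_det e1 e2 v w"
    using rotation90_on_inner[OF assms] by metis
  then show "J v \<in> P" "v \<bullet> J v = 0" 
    by (simp_all add: plane_det_expand inner_commute[of v])
qed

text \<open>The vectors orthogonal to a nonzero \<open>u \<in> P\<close> all project to the same line of the plane \<open>P\<close>.\<close>

lemma plane_det_eq_0:
  assumes e: "orthonormal_basis P e1 e2" and "u \<in> P" "u \<noteq> 0" and "u \<bullet> v = 0" "u \<bullet> w = 0"
  shows "plane_det e1 e2 v w = 0"
proof -
  have v: "(u \<bullet> e1) * (v \<bullet> e1) + (u \<bullet> e2) * (v \<bullet> e2) = 0"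
    and w: "(u \<bullet> e1) * (w \<bullet> e1) + (u \<bullet> e2) * (w \<bullet> e2) = 0"
    using assms orthonormal_basis_inner[OF e \<open>u \<in> P\<close>] by metis+
  \<comment> \<open>Cramer's rule: the coordinates of \<open>u\<close> solve a homogeneous system with this determinant.\<close>
  have "(u \<bullet> e1) * plane_det e1 e2 v w = 0" "(u \<bullet> e2) * plane_det e1 e2 v w = 0"
    using v w unfolding plane_det_expand by algebra+
  moreover have "u \<bullet> e1 \<noteq> 0 \<or> u \<bullet> e2 \<noteq> 0"
    using orthonormal_basis_expand[OF e \<open>u \<in> P\<close>] \<open>u \<noteq> 0\<close> by force
  ultimately show ?thesis by auto
qed

text \<open>The vanishing determinant puts \<open>b\<close> on the line spanned by the projection of \<open>a\<close> to \<open>P\<close>,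
  the condition \<open>u \<bullet> b = 0\<close> on the line of \<open>P\<close> orthogonal to \<open>u\<close>; these lines are distinct because \<open>u\<close> is
  not orthogonal to \<open>a\<close>.\<close>

lemma plane_det_eq_0_imp_zero:
  assumes e: "orthonormal_basis P e1 e2" and "b \<in> P" "u \<in> P"
    and 0: "plane_det e1 e2 a b = 0" "u \<bullet> b = 0" "u \<bullet> a \<noteq> 0"
  shows "b = 0"
proof -
  have i: "u \<bullet> z = (u \<bullet> e1) * (z \<bullet> e1) + (u \<bullet> e2) * (z \<bullet> e2)" for z
    by (rule orthonormal_basis_inner[OF e \<open>u \<in> P\<close>])
  have "(b \<bullet> e1) * (u \<bullet> a) = 0" "(b \<bullet> e2) * (u \<bullet> a) = 0"
    using 0(1,2) unfolding plane_det_expand i[of a] i[of b] by algebra+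
  then have "b \<bullet> e1 = 0" "b \<bullet> e2 = 0" using 0(3) by auto
  then show ?thesis using orthonormal_basis_expand[OF e \<open>b \<in> P\<close>] by simp
qed

lemma second_ff_in_normal_plane:
  assumes "immersed_surface M" "m \<in> topspace (points M)"
  shows "second_ff M m x y \<in> normal_plane M m"
  unfolding second_ff_def second_ff_field_def by (rule tangential_normal(2)[OF assms])

lemma second_ff_zero_left:
  assumes M: "immersed_surface M" and m: "m \<in> topspace (points M)" and y: "y \<in> tangent_plane M m"
  shows "second_ff M m 0 y = 0"
proof -
  define c where "c = chart_at M m"
  have c: "c \<in> charts M" and mc: "m \<in> fst c"
    using chart_at[OF M m] unfolding c_def by auto
  let ?U = "snd c ` fst c"
  have p: "snd c m \<in> ?U" using mc by blast
  have "0 \<in> tangent_plane M m"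
    using subspace_0[OF tangent_plane_subspace(1)[OF M m]] .
  from tangent_field_extend(2)[OF M m this]
  have X: "extend M m 0 m = frame M c (snd c m) 0"
    unfolding linear_0[OF linear_frame[OF M c p]] .
  have "second_ff M m 0 y = nhess M c (snd c m) (coords M m y) 0"
    unfolding second_ff_def
    by (rule second_ff_coords(1)[OF M c open_chart_domain[OF M c] subset_refl mc p
          tangent_field_extend(1)[OF M m y, folded c_def] has_derivative_const,
          where X = "extend M m 0" and v = 0])
      (rule X)
  then show ?thesis using linear_0[OF nhess_linear2[OF M c p]] by simp
qed

lemma tangential_of_normal:
  assumes "immersed_surface M" "m \<in> topspace (points M)" "u \<in> normal_plane M m"
  shows "tangential M m u = 0"
  using tangential_normal(3)[OF assms(1,2), of 0 u] assms(3)
    subspace_0[OF tangent_plane_subspace(1)[OF assms(1,2)]] by simp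

text \<open>The two second order terms of \<open>d3\<close> cancel because \<open>u \<bullet> \<alpha>(x, x) = x \<bullet> x\<close>, so only the
  third order term is left.\<close>

lemma rib_direction_orthogonal_cov_deriv:
  assumes M: "immersed_surface M" "m \<in> topspace (points M)" and x: "x \<in> tangent_plane M m"
    and u: "determines_rib_direction M m x u"
  shows "u \<bullet> cov_deriv_second_ff M m x x x = 0"
proof -
  have N: "u \<in> normal_plane M m" and xx: "x \<bullet> x - u \<bullet> second_ff M m x x = 0"
    and d: "d3 M m u x = 0"
    using u x unfolding determines_rib_direction_def by auto
  have T: "tangential M m u = 0" by (rule tangential_of_normal[OF M N])
  have "u \<bullet> x = 0"
    using N x unfolding normal_plane_def orthogonal_comp_def orthogonal_def
    by (auto simp: inner_commute)
  with d xx show ?thesis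
    unfolding d3_def normal_def T by (simp add: second_ff_zero_left[OF M x])
qed

theorem theorem5p1:
  fixes M :: "'a surface" and m :: 'a and x :: "real^4"
    and JT JN :: "real^4 \<Rightarrow> real^4" and n1 n2 :: "real^4"
  assumes "immersed_surface M" and "m \<in> topspace (points M)"
    and "rotation90_on (tangent_plane M m) JT"
    and "rotation90_on (normal_plane M m) JN"
    and "orthonormal_basis (normal_plane M m) n1 n2"
    and "strong_principal_direction M m x"
  shows "second_ff M m x x \<noteq> 0 \<and>
    (JN (second_ff M m x x) \<bullet> second_ff M m x (JT x) \<noteq> 0 \<or> second_ff M m x (JT x) = 0) \<and>
    plane_det n1 n2 (second_ff M m x (JT x)) (cov_deriv_second_ff M m x x x) = 0"
proof -
  note M = assms(1,2)
  obtain u where x: "x \<noteq> 0" "x \<in> tangent_plane M m" and u: "determines_rib_direction M m x u"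
    using assms(6) unfolding strong_principal_direction_def by blast
  have un: "u \<noteq> 0" "u \<in> normal_plane M m"
    and ii: "\<And>y. y \<in> tangent_plane M m \<Longrightarrow> u \<bullet> second_ff M m x y = x \<bullet> y"
    using u unfolding determines_rib_direction_def by auto
  note J = rotation90_on_orthogonal[OF assms(3) x(2)]
  have a: "u \<bullet> second_ff M m x x \<noteq> 0" using ii[OF x(2)] x(1) by simp
  have b: "u \<bullet> second_ff M m x (JT x) = 0" using ii[OF J(1)] J(2) by simp
  have 1: "second_ff M m x x \<noteq> 0" using a by auto
  have 2: "second_ff M m x (JT x) = 0" if "JN (second_ff M m x x) \<bullet> second_ff M m x (JT x) = 0"
  proof -
    obtain e1 e2 where e: "orthonormal_basis (normal_plane M m) e1 e2"
      and JN: "\<And>w. JN (second_ff M m x x) \<bullet> w = plane_det e1 e2 (second_ff M m x x) w"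
      using rotation90_on_inner[OF assms(4) second_ff_in_normal_plane[OF M, of x x]] by metis
    show ?thesis
      by (rule plane_det_eq_0_imp_zero[OF e second_ff_in_normal_plane[OF M] un(2) that[unfolded JN] b a])
  qed
  have 3: "plane_det n1 n2 (second_ff M m x (JT x)) (cov_deriv_second_ff M m x x x) = 0"
    by (rule plane_det_eq_0[OF assms(5) un(2,1) b rib_direction_orthogonal_cov_deriv[OF M x(2) u]])
  show ?thesis using 1 2 3 by blast
qed

end
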